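(* Let $s,t$ be positive integers and let $n,k,r$ be integers with $n\ge k\ge 4$ and $r\ge 1$. Let $G$ be a connected graph on $n$ vertices with $\delta(G)\ge r$, and put $h=\lfloor\frac{k-2}{2}\rfloor$. If $$N(K_{s,t},G)>\max\{g_{s,t}(n,k-1,r),\ g_{s,t}(n,k-1,h)\},$$ then $G$ contains a path on $k$ vertices.
   Context: $N(K_{s,t},G)$ denotes the number of (not necessarily induced) copies of the complete bipartite graph $K_{s,t}$ in $G$; $\delta(G)$ is the minimum degree. For integers $n,k,a$ define $$g_{s,t}(n,k,a)=\begin{cases}\displaystyle\sum_{i=1}^{n-k+a}\binom{a}{s}\binom{n-s-i}{s-1}+\frac12\binom{k-a}{2s}\binom{2s}{s}, & s=t,\\[2mm] \displaystyle\sum_{i=1}^{n-k+a}\left(\binom{a}{s}\binom{n-s-i}{t-1}+\binom{a}{t}\binom{n-t-i}{s-1}\right)+\binom{k-a}{s+t}\binom{s+t}{s}, & s\neq t.\end{cases}$$ *)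

theory Defs
  imports Complex_Main "Graph_Theory.Graph_Theory"
begin

text \<open>
  Finite simple graphs are the \<^locale>\<open>graph\<close>s of \<^theory>\<open>Graph_Theory.Digraph\<close>: finite
  loop-free symmetric digraphs without parallel arcs, an edge being a pair of opposite arcs.
\<close>

text \<open>By symmetry the out-degree is the number of neighbours.\<close>

definition min_degree :: "('a, 'b) pre_digraph \<Rightarrow> nat" where
  "min_degree G = Min (out_degree G ` verts G)"

text \<open>
  A copy of \<open>K\<^sub>s\<^sub>,\<^sub>t\<close> is a not necessarily induced subgraph, so copies are unlabelled and for \<open>s = t\<close>
  exchanging the two sides gives the same copy. A subgraph shares the functions \<^const>\<open>tail\<close> and
  \<^const>\<open>head\<close> with \<open>G\<close>, hence is determined by its vertices and arcs.
\<close>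

definition num_complete_bipartite :: "nat \<Rightarrow> nat \<Rightarrow> ('a, 'b) pre_digraph \<Rightarrow> nat" where
  "num_complete_bipartite s t G = card {H. subgraph H G \<and> complete_bipartite_digraph s t H}"

text \<open>Binomial coefficients with integer upper argument, zero if that argument is negative.\<close>

definition ibinom :: "int \<Rightarrow> nat \<Rightarrow> nat" where
  "ibinom m j = (if m < 0 then 0 else nat m choose j)"

definition g :: "nat \<Rightarrow> nat \<Rightarrow> int \<Rightarrow> int \<Rightarrow> int \<Rightarrow> real" where
  "g s t n k a =
    (if s = t then
       (\<Sum>i = 1..n - k + a. real (ibinom a s) * real (ibinom (n - int s - i) (s - 1)))
         + 1 / 2 * real (ibinom (k - a) (2 * s)) * real ((2 * s) choose s)
     else
       (\<Sum>i = 1..n - k + a. real (ibinom a s) * real (ibinom (n - int s - i) (t - 1))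
                          + real (ibinom a t) * real (ibinom (n - int t - i) (s - 1)))
         + real (ibinom (k - a) (s + t)) * real ((s + t) choose s))"

end

theory Submission
  imports Defs
begin

text \<open>
  Following Kopylov, add edges to a graph without a path on \<open>k\<close> vertices as long as none appears. Then
  any two non-adjacent vertices \<open>x\<close>, \<open>y\<close> start two disjoint paths with \<open>k\<close> vertices in total. If \<open>A\<close>
  and \<open>B\<close> induce subgraphs of minimum degree \<open>a\<close> and \<open>b\<close> with \<open>a + b + 1 \<ge> k\<close>, a longest such
  pair with \<open>x \<in> A\<close>, \<open>y \<in> B\<close> could be rerouted to a single path on \<open>k\<close> vertices; hence every
  vertex of \<open>A\<close> is adjacent to every other vertex of \<open>B\<close>.

  Let \<open>H\<close> be what remains after repeatedly deleting vertices of degree at most \<open>h\<close>. If \<open>H\<close> is empty,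
  counting the copies destroyed by each deletion gives the bound with parameter \<open>h\<close>. Otherwise the
  adjacency result, applied to \<open>(H, H)\<close>, to \<open>(V, H)\<close> and to the pair of \<open>H\<close> with the remainder after
  deleting degrees at most \<open>a = k - 1 - |H|\<close>, shows that \<open>H\<close> is complete, that \<open>r \<le> a \<le> h\<close>, and that
  the last remainder is \<open>H\<close> itself. Counting deletions gives the bound with parameter \<open>a\<close>, and
  this bound is convex in the parameter.
\<close>

section \<open>Paths and cycles\<close>

definition simple_path :: "('a \<times> 'a) set \<Rightarrow> 'a list \<Rightarrow> bool" where
  "simple_path E p \<longleftrightarrow> distinct p \<and> successively (\<lambda>u v. (u, v) \<in> E) p"

lemma simple_path_rev:
  assumes "sym E"
  shows "simple_path E (rev p) \<longleftrightarrow> simple_path E p"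
proof -
  have "(\<lambda>u v. (v, u) \<in> E) = (\<lambda>u v. (u, v) \<in> E)"
    using assms by (auto simp: fun_eq_iff dest: symD)
  then have "successively (\<lambda>u v. (u, v) \<in> E) (rev p) \<longleftrightarrow> successively (\<lambda>u v. (u, v) \<in> E) p"
    unfolding successively_rev by (simp only:)
  then show ?thesis by (simp add: simple_path_def)
qed

lemma simple_path_trivial [simp]: "simple_path E []" "simple_path E [x]"
  by (simp_all add: simple_path_def)

lemma simple_path_append:
  "simple_path E (p @ q) \<longleftrightarrow> simple_path E p \<and> simple_path E q \<and> set p \<inter> set q = {}
     \<and> (p = [] \<or> q = [] \<or> (last p, hd q) \<in> E)"
  by (auto simp: simple_path_def successively_append_iff)

lemma simple_path_Cons:
  "simple_path E (x # p) \<longleftrightarrow> x \<notin> set p \<and> simple_path E p \<and> (p = [] \<or> (x, hd p) \<in> E)"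
  using simple_path_append[of E "[x]" p] by (auto simp: simple_path_def)

lemma rtrancl_imp_simple_path:
  assumes "(u, v) \<in> E\<^sup>*"
  shows "\<exists>p. p \<noteq> [] \<and> simple_path E p \<and> hd p = u \<and> last p = v"
  using assms
proof (induction rule: rtrancl_induct)
  case base
  have "[u] \<noteq> [] \<and> simple_path E [u] \<and> hd [u] = u \<and> last [u] = u"
    by (simp add: simple_path_def)
  then show ?case by blast
next
  case (step y z)
  then obtain p where p: "p \<noteq> []" "simple_path E p" "hd p = u" "last p = y" by blast
  show ?case
  proof (cases "z \<in> set p")
    case True
    then obtain p1 p2 where s: "p = p1 @ z # p2" by (meson split_list)
    then have "p = (p1 @ [z]) @ p2" by simp
    then have "simple_path E (p1 @ [z])" using p(2) by (metis simple_path_append)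
    moreover have "hd (p1 @ [z]) = u" using p(3) s by (cases p1) auto
    ultimately show ?thesis by (intro exI[of _ "p1 @ [z]"]) simp
  next
    case False
    then have "simple_path E (p @ [z])" "hd (p @ [z]) = u"
      using p step by (auto simp: simple_path_append)
    then show ?thesis by (intro exI[of _ "p @ [z]"]) simp
  qed
qed

text \<open>On a path from \<open>x\<close> to \<open>y\<close>, the last vertex in \<open>S\<close>
  and the first later vertex in \<open>T\<close> cut out a segment whose inner vertices avoid both
  sets.\<close>

lemma connecting_path:
  assumes "x \<in> S" "y \<in> T" "S \<inter> T = {}" "(x, y) \<in> E\<^sup>*"
  obtains c d q where "c \<in> S" "d \<in> T" "simple_path E (c # q @ [d])" "set q \<inter> (S \<union> T) = {}"
proof -
  obtain p where p: "p \<noteq> []" "simple_path E p" "hd p = x" "last p = y"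
    using rtrancl_imp_simple_path[OF assms(4)] by blast
  have "\<exists>c\<in>set p. c \<in> S" using p assms(1) by auto
  then obtain p1 c p2 where c: "p = p1 @ c # p2" "c \<in> S" "\<forall>v\<in>set p2. v \<notin> S"
    by (rule split_list_last_propE)
  have "p2 \<noteq> []" using p(4) c(1,2) assms(2,3) by auto
  then have "\<exists>d\<in>set p2. d \<in> T" using p(4) c(1) assms(2) by auto
  then obtain q d p3 where d: "p2 = q @ d # p3" "d \<in> T" "\<forall>v\<in>set q. v \<notin> T"
    by (rule split_list_first_propE)
  have eq: "p = p1 @ (c # q @ [d]) @ p3" using c d by simp
  have "simple_path E ((c # q @ [d]) @ p3)" using p(2) unfolding eq
    using simple_path_append by blast
  then have "simple_path E (c # q @ [d])" using simple_path_append by blast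
  moreover have "set q \<inter> (S \<union> T) = {}" using c d by auto
  ultimately show thesis using that c(2) d(2) by blast
qed

text \<open>The endpoint is reached either along \<open>p\<close> directly, or against \<open>p\<close> by jumping from the end
  of \<open>p\<close> back through \<open>x\<close>.\<close>

lemma path_ending_at:
  assumes "simple_path E p" "p \<noteq> []" "hd p = x" "c \<in> set p" "sym E" "irrefl E"
  obtains q where "simple_path E q" "q \<noteq> []" "last q = c" "set q \<subseteq> set p"
    "card {v \<in> set p. (x, v) \<in> E} < length q"
proof -
  obtain p1 p2 where s: "p = p1 @ c # p2" using assms(4) by (meson split_list)
  have hd1: "hd (p1 @ [c]) = x" using assms(3) s by (cases p1) auto
  have sp1: "simple_path E (p1 @ [c])" and sp2: "simple_path E p2"
    and dj: "set (p1 @ [c]) \<inter> set p2 = {}"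
    using assms(1) unfolding s using simple_path_append[of E "p1 @ [c]" p2] by auto
  have xin: "x \<in> set (p1 @ [c])" using hd1 by (metis hd_in_set snoc_eq_iff_butlast)
  have len: "card {v \<in> set p. (x, v) \<in> E} < length q"
    if "simple_path E q" "insert x {v \<in> set p. (x, v) \<in> E} \<subseteq> set q" for q
  proof -
    have "x \<notin> {v \<in> set p. (x, v) \<in> E}" using assms(6) by (simp add: irrefl_def)
    then have "card {v \<in> set p. (x, v) \<in> E} < card (insert x {v \<in> set p. (x, v) \<in> E})"
      by simp
    also have "\<dots> \<le> card (set q)" using that(2) by (simp add: card_mono)
    also have "\<dots> = length q" using that(1) by (simp add: simple_path_def distinct_card)
    finally show ?thesis .
  qed
  show thesis
  proof (cases "\<exists>v\<in>set p2. (x, v) \<in> E")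
    case False
    have "insert x {v \<in> set p. (x, v) \<in> E} \<subseteq> set (p1 @ [c])"
      using False xin s by auto
    then show thesis using that[of "p1 @ [c]"] len[of "p1 @ [c]"] sp1 s by auto
  next
    case True
    \<comment> \<open>\<open>e\<close> is the first neighbour of \<open>x\<close> behind
      \<open>c\<close>, so all of them lie on \<open>e # w\<close>.\<close>
    then obtain u e w where e: "p2 = u @ e # w" "(x, e) \<in> E" "\<forall>v\<in>set u. (x, v) \<notin> E"
      by (rule split_list_first_propE) auto
    have "simple_path E (e # w)" using sp2 e(1) simple_path_append by blast
    then have "simple_path E (rev (e # w))" using simple_path_rev[OF assms(5)] by blast
    moreover have "(last (rev (e # w)), hd (p1 @ [c])) \<in> E"
      using e(2) assms(5) hd1 by (auto dest: symD)
    moreover have "set (rev (e # w)) \<inter> set (p1 @ [c]) = {}" using dj e(1) by auto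
    ultimately have *: "simple_path E (rev (e # w) @ p1 @ [c])"
      using sp1 by (simp only: simple_path_append[of E "rev (e # w)"]) simp
    have "insert x {v \<in> set p. (x, v) \<in> E} \<subseteq> set (rev (e # w) @ p1 @ [c])"
      using e xin s by auto
    then show thesis using that[of "rev (e # w) @ p1 @ [c]"] len[OF *] * s e by auto
  qed
qed

text \<open>For a crossing pair \<open>a < b\<close>, run from the start to \<open>Z ! a\<close>,
  jump to the end, go back to \<open>Z ! b\<close> and close up at the start. With
  \<open>b - a\<close> minimal, only vertices adjacent to neither end are skipped.\<close>

lemma crossing_cycle:
  assumes Z: "simple_path R Z" and R: "sym R" "irrefl R"
    and nadj: "(Z ! 0, Z ! (length Z - 1)) \<notin> R"
    and A_def: "A = {i. i < length Z \<and> (Z ! 0, Z ! i) \<in> R}"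
    and B_def: "B = {i. i < length Z \<and> (Z ! (length Z - 1), Z ! i) \<in> R}"
    and ab: "a0 < b0" "a0 \<in> B" "b0 \<in> A"
  obtains C where "C \<noteq> []" "simple_path R C" "(last C, hd C) \<in> R" "set C \<subseteq> set Z"
    "min (length Z) (card A + card B) \<le> length C"
proof -
  let ?M = "length Z"
  define P where "P = (\<lambda>(a, b). a < b \<and> a \<in> B \<and> b \<in> A)"
  have "P (a0, b0)" using ab by (simp add: P_def)
  then obtain ab where ab: "P ab" and min: "\<And>cd. P cd \<Longrightarrow> snd ab - fst ab \<le> snd cd - fst cd"
    using ex_has_least_nat[of P "(a0, b0)" "\<lambda>(a, b). b - a"] by (auto simp: case_prod_beta)
  obtain a b where "ab = (a, b)" by fastforce
  then have a: "a < b" "a \<in> B" "b \<in> A"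
    and min: "\<And>c d. c < d \<Longrightarrow> c \<in> B \<Longrightarrow> d \<in> A \<Longrightarrow> b - a \<le> d - c"
    using ab min by (auto simp: P_def)
  have gap: "i \<notin> A \<union> B" if "a < i" "i < b" for i
    using min[of a i] min[of i b] that a by auto
  have bM: "b < ?M" and aM: "a < ?M" using a by (auto simp: A_def B_def)
  have M: "0 \<notin> A" "?M - 1 \<notin> A" "0 \<notin> B" "?M - 1 \<notin> B" "A \<subseteq> {..<?M}" "B \<subseteq> {..<?M}"
    using R nadj by (auto simp: A_def B_def irrefl_def dest: symD)
  let ?C = "take (Suc a) Z @ rev (drop b Z)"
  have ne: "take (Suc a) Z \<noteq> []" "drop b Z \<noteq> []" using bM aM by auto
  have sp: "simple_path R (take (Suc a) Z)" "simple_path R (drop b Z)"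
    using Z simple_path_append[of R "take (Suc a) Z" "drop (Suc a) Z"]
      simple_path_append[of R "take b Z" "drop b Z"] by auto
  have dj: "set (take (Suc a) Z) \<inter> set (drop b Z) = {}"
    using Z a(1) set_take_disj_set_drop_if_distinct[of Z "Suc a" b] by (simp add: simple_path_def)
  have lt: "last (take (Suc a) Z) = Z ! a" using aM by (simp add: take_Suc_conv_app_nth)
  have ld: "hd (rev (drop b Z)) = Z ! (?M - 1)"
    using bM ne by (simp add: hd_rev last_drop last_conv_nth)
  have e1: "(Z ! a, Z ! (?M - 1)) \<in> R" using a(2) R(1) by (auto simp: B_def dest: symD)
  have spC: "simple_path R ?C"
    unfolding simple_path_append using sp dj lt ld e1 R(1) by (auto simp: simple_path_rev)
  have "hd ?C = Z ! 0" using ne bM by (cases Z) (auto simp: hd_conv_nth)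
  moreover have "last ?C = Z ! b" using ne bM by (simp add: last_rev hd_drop_conv_nth)
  ultimately have close: "(last ?C, hd ?C) \<in> R" using a(3) R(1) by (auto simp: A_def dest: symD)
  have lenC: "length ?C = Suc a + (?M - b)" using aM bM by simp
  have "min ?M (card A + card B) \<le> length ?C"
  proof (cases "b = Suc a")
    case True
    then show ?thesis using lenC bM by simp
  next
    case False
    \<comment> \<open>A consecutive pair would be a crossing with difference 1, below the
      minimum.\<close>
    have nocons: "i \<notin> B" if "Suc i \<in> A" for i
      using min[of i "Suc i"] that a(1) False by fastforce
    \<comment> \<open>Shifted down by one, \<open>A\<close> becomes disjoint from \<open>B\<close>,
      and both fit into an index set with exactly as many elements as the cycle.\<close>
    define A' where "A' = (\<lambda>i. i - 1) ` A"
    have A'_iff: "i \<in> A' \<longleftrightarrow> Suc i \<in> A" for i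
    proof
      assume "i \<in> A'"
      then obtain j where "j \<in> A" "i = j - 1" by (auto simp: A'_def)
      then show "Suc i \<in> A" using M(1) by (cases j) auto
    next
      assume "Suc i \<in> A" then show "i \<in> A'" unfolding A'_def by force
    qed
    have fin: "finite A" "finite B" using M by (meson finite_lessThan finite_subset)+
    have "inj_on (\<lambda>i. i - 1) A"
    proof (rule inj_onI)
      fix i j assume "i \<in> A" "j \<in> A" "i - 1 = j - 1"
      then show "i = j" using M(1) by (cases i; cases j) auto
    qed
    then have "card A' = card A" by (simp add: A'_def card_image)
    moreover have "A' \<inter> B = {}" using nocons A'_iff by auto
    ultimately have "card A + card B = card (A' \<union> B)"
      using fin by (simp add: card_Un_disjoint A'_def)
    also have "\<dots> \<le> card ({..a} \<union> {b - 1..<?M - 1})"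
    proof (rule card_mono)
      show "A' \<union> B \<subseteq> {..a} \<union> {b - 1..<?M - 1}"
      proof
        fix i assume i: "i \<in> A' \<union> B"
        have "i < ?M - 1"
        proof (cases "i \<in> B")
          case True
          then have "i < ?M" "i \<noteq> ?M - 1" using M by auto
          then show ?thesis by simp
        next
          case False
          then have "Suc i \<in> A" using i A'_iff by auto
          then show ?thesis using M(5) by auto
        qed
        moreover have "i \<le> a \<or> b - 1 \<le> i"
          using i gap[of i] gap[of "Suc i"] A'_iff[of i] by force
        ultimately show "i \<in> {..a} \<union> {b - 1..<?M - 1}" by auto
      qed
    qed simp
    also have "\<dots> \<le> card {..a} + card {b - 1..<?M - 1}" by (rule card_Un_le)
    also have "\<dots> = Suc a + (?M - b)" using a(1) bM by simp
    finally show ?thesis using lenC by linarith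
  qed
  moreover have "set ?C \<subseteq> set Z" by (auto dest: in_set_takeD in_set_dropD)
  ultimately show thesis using that[of ?C] spC close ne by simp
qed

section \<open>Linked pairs of paths and addition of edges\<close>

definition linked :: "('a \<times> 'a) set \<Rightarrow> 'a \<Rightarrow> 'a \<Rightarrow> 'a list \<Rightarrow> 'a list \<Rightarrow> bool" where
  "linked E x y p q \<longleftrightarrow>
     simple_path E (x # p) \<and> simple_path E (y # q) \<and> set (x # p) \<inter> set (y # q) = {}"

lemma successively_remove_edge:
  assumes "successively (\<lambda>u v. (u, v) \<in> insert (x, y) (insert (y, x) E)) p"
    and "x \<notin> set p \<or> y \<notin> set p"
  shows "successively (\<lambda>u v. (u, v) \<in> E) p"
  using assms(1) by (rule successively_mono) (use assms(2) in auto)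

text \<open>The vertices of a path are distinct, so it uses the new edge at most once; cutting there
  leaves two paths over \<open>E\<close>.\<close>

lemma path_through_new_edge:
  assumes "simple_path (insert (x, y) (insert (y, x) E)) p" "\<not> simple_path E p"
  obtains u w a b where "p = u @ a # b # w" "{a, b} = {x, y}"
    "simple_path E (u @ [a])" "simple_path E (b # w)"
proof -
  have "\<exists>u w a b. p = u @ a # b # w \<and> {a, b} = {x, y} \<and> simple_path E (u @ [a]) \<and> simple_path E (b # w)"
    using assms
  proof (induction p)
    case Nil then show ?case by (simp add: simple_path_def)
  next
    case (Cons a p)
    then obtain b r where p: "p = b # r" by (cases p) (auto simp: simple_path_def)
    let ?E = "insert (x, y) (insert (y, x) E)"
    have sp: "simple_path ?E p" "a \<notin> set p" "(a, b) \<in> ?E"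
      using Cons.prems(1) p by (auto simp: simple_path_Cons)
    show ?case
    proof (cases "(a, b) \<in> E")
      case True
      then have "\<not> simple_path E p" using Cons.prems sp p by (auto simp: simple_path_Cons)
      then obtain u w c d where *: "p = u @ c # d # w" "{c, d} = {x, y}"
        "simple_path E (u @ [c])" "simple_path E (d # w)" using Cons.IH sp(1) by blast
      have "hd (u @ [c]) = b" using *(1) p by (cases u) auto
      then have "simple_path E ((a # u) @ [c])" using * sp True by (auto simp: simple_path_Cons)
      then show ?thesis using * by (metis append_Cons)
    next
      case False
      then have ab: "{a, b} = {x, y}" using sp(3) by auto
      then have "x \<notin> set p \<or> y \<notin> set p" using sp(2) by auto
      then have "simple_path E (b # r)"
        using successively_remove_edge[of x y E p] sp(1) p by (simp add: simple_path_def)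
      moreover have "simple_path E ([] @ [a])" by (simp add: simple_path_def)
      ultimately show ?thesis using ab p by (metis append_Nil)
    qed
  qed
  then show thesis using that by blast
qed

text \<open>Take \<open>F\<close> as large as possible. One more edge between \<open>x\<close> and
  \<open>y\<close> creates a path on at least \<open>k\<close> vertices; it must use that edge, and
  its two pieces, read from the cut outwards, form the linked pair.\<close>

lemma edge_maximal_extension:
  fixes E :: "('a \<times> 'a) set"
  assumes "finite V" "E \<subseteq> V \<times> V" "sym E" "irrefl E"
    and "\<And>p. simple_path E p \<Longrightarrow> set p \<subseteq> V \<Longrightarrow> length p < k"
  obtains F where "E \<subseteq> F" "F \<subseteq> V \<times> V" "sym F" "irrefl F"
    "\<And>p. simple_path F p \<Longrightarrow> set p \<subseteq> V \<Longrightarrow> length p < k"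
    "\<And>x y. x \<in> V \<Longrightarrow> y \<in> V \<Longrightarrow> x \<noteq> y \<Longrightarrow> (x, y) \<notin> F \<Longrightarrow>
       \<exists>p q. linked F x y p q \<and> k \<le> length (x # p) + length (y # q)"
proof -
  define P where "P = (\<lambda>F. E \<subseteq> F \<and> F \<subseteq> V \<times> V \<and> sym F \<and> irrefl F \<and>
    (\<forall>p. simple_path F p \<longrightarrow> set p \<subseteq> V \<longrightarrow> length p < k))"
  have "P E" using assms by (auto simp: P_def)
  have bd: "card F \<le> card (V \<times> V)" if "P F" for F
    using that assms(1) by (intro card_mono) (auto simp: P_def)
  have "\<exists>F. P F \<and> (\<forall>F'. P F' \<longrightarrow> card F' \<le> card F)"
    by (rule ex_has_greatest_nat[of P E card "Suc (card (V \<times> V))"])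
      (use \<open>P E\<close> bd in \<open>auto simp: less_Suc_eq_le\<close>)
  then obtain F where F: "P F" and max: "\<And>F'. P F' \<Longrightarrow> card F' \<le> card F"
    by blast
  have "\<exists>p q. linked F x y p q \<and> k \<le> length (x # p) + length (y # q)"
    if xy: "x \<in> V" "y \<in> V" "x \<noteq> y" "(x, y) \<notin> F" for x y
  proof -
    let ?F = "insert (x, y) (insert (y, x) F)"
    have "finite ?F" using F assms(1) by (auto simp: P_def intro: finite_subset)
    then have "card F < card ?F" by (rule psubset_card_mono) (use xy(4) in blast)
    then have "\<not> P ?F" using max by fastforce
    moreover have "sym ?F" "irrefl ?F" "E \<subseteq> ?F" "?F \<subseteq> V \<times> V"
      using F xy by (auto simp: P_def sym_def irrefl_def)
    ultimately obtain p where p: "simple_path ?F p" "set p \<subseteq> V" "k \<le> length p"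
      by (auto simp: P_def not_less)
    then have "\<not> simple_path F p" using F unfolding P_def by (meson not_less)
    then obtain u w a b where *: "p = u @ a # b # w" "{a, b} = {x, y}"
      "simple_path F (u @ [a])" "simple_path F (b # w)"
      using path_through_new_edge[OF p(1)] by metis
    have "sym F" using F by (simp add: P_def)
    then have r: "simple_path F (a # rev u)"
      using *(3) simple_path_rev[of F "u @ [a]"] by simp
    have d: "set (a # rev u) \<inter> set (b # w) = {}"
      using p(1) *(1) by (auto simp: simple_path_def)
    have l: "k \<le> length (a # rev u) + length (b # w)" using p(3) *(1) by simp
    consider "a = x" "b = y" | "a = y" "b = x" using *(2) by (auto simp: doubleton_eq_iff)
    then show ?thesis
    proof cases
      case 1
      then show ?thesis using r d l *(4) unfolding linked_def by blast
    next
      case 2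
      then show ?thesis using r d l *(4) unfolding linked_def
        by (intro exI[of _ w] exI[of _ "rev u"]) (auto simp: Int_commute)
    qed
  qed
  then show thesis using that[of F] F by (auto simp: P_def)
qed

text \<open>Two disjoint paths are joined to a single one through the new vertex \<open>None\<close>, which makes the
  exchange argument for cycles applicable to pairs of paths.\<close>

definition cone :: "'a set \<Rightarrow> ('a \<times> 'a) set \<Rightarrow> ('a option \<times> 'a option) set" where
  "cone V E = map_prod Some Some ` E \<union> {None} \<times> Some ` V \<union> Some ` V \<times> {None}"

lemma cone_simps [simp]:
  "(Some u, Some v) \<in> cone V E \<longleftrightarrow> (u, v) \<in> E"
  "(None, Some v) \<in> cone V E \<longleftrightarrow> v \<in> V"
  "(Some v, None) \<in> cone V E \<longleftrightarrow> v \<in> V"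
  "(None, None) \<notin> cone V E"
  by (auto simp: cone_def)

lemma sym_cone: "sym E \<Longrightarrow> sym (cone V E)"
  by (auto simp: cone_def sym_def)

lemma irrefl_cone: "irrefl E \<Longrightarrow> irrefl (cone V E)"
  by (auto simp: cone_def irrefl_def)

lemma simple_path_cone_Some [simp]:
  "simple_path (cone V E) (map Some p) \<longleftrightarrow> simple_path E p"
  by (simp add: simple_path_def distinct_map successively_map)

text \<open>Removing \<open>None\<close> opens a cycle into a path at the cost of one vertex; a
  cycle without \<open>None\<close> is already a path of the original graph.\<close>

lemma cycle_cone_imp_path:
  assumes "C \<noteq> []" "simple_path (cone V E) C" "(last C, hd C) \<in> cone V E"
  obtains p where "simple_path E p" "Some ` set p \<subseteq> set C" "length C \<le> Suc (length p)"
proof -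
  have lift: "\<exists>p. xs = map Some p" if "None \<notin> set xs" for xs :: "'a option list"
    using that by (intro exI[of _ "map the xs"]) (induction xs, auto)
  show thesis
  proof (cases "None \<in> set C")
    case False
    then obtain p where "C = map Some p" using lift by blast
    then show thesis using that[of p] assms(2) by simp
  next
    case True
    then obtain C1 C2 where C: "C = C1 @ None # C2" by (meson split_list)
    have "simple_path (cone V E) C1" "simple_path (cone V E) (None # C2)"
      "set C1 \<inter> set (None # C2) = {}" using assms(2) unfolding C simple_path_append by auto
    moreover have "C1 = [] \<or> C2 = [] \<or> (last C2, hd C1) \<in> cone V E"
      using assms(3) C by (cases C1; cases "C2 = []") auto
    ultimately have "simple_path (cone V E) (C2 @ C1)" "None \<notin> set (C2 @ C1)"
      unfolding simple_path_append by (auto simp: simple_path_Cons)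
    moreover obtain p where "C2 @ C1 = map Some p" using lift calculation(2) by blast
    moreover have "Some ` set p \<subseteq> set C" 
    proof -
      have "Some ` set p = set (C2 @ C1)" using \<open>C2 @ C1 = map Some p\<close> by simp
      then show ?thesis using C by auto
    qed
    moreover have "length C = Suc (length p)"
      using C arg_cong[OF \<open>C2 @ C1 = map Some p\<close>, of length] by simp
    ultimately show thesis using that[of p] by simp
  qed
qed

section \<open>Edge-maximal graphs without long paths\<close>

locale edge_maximal_graph =
  fixes V :: "'a set" and E :: "('a \<times> 'a) set" and k :: nat
  assumes finite_V: "finite V" and edges: "E \<subseteq> V \<times> V" and sym: "sym E" and irrefl: "irrefl E"
    and connected: "\<And>u v. u \<in> V \<Longrightarrow> v \<in> V \<Longrightarrow> (u, v) \<in> E\<^sup>*"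
    and no_path: "\<And>p. simple_path E p \<Longrightarrow> set p \<subseteq> V \<Longrightarrow> length p < k"
    and maximal: "\<And>x y. x \<in> V \<Longrightarrow> y \<in> V \<Longrightarrow> x \<noteq> y \<Longrightarrow> (x, y) \<notin> E \<Longrightarrow>
      \<exists>p q. linked E x y p q \<and> k \<le> length (x # p) + length (y # q)"
begin

lemma path_in_V:
  assumes "simple_path E p" "p \<noteq> []" "hd p \<in> V"
  shows "set p \<subseteq> V"
  using assms
proof (induction p)
  case (Cons x p)
  then show ?case using edges by (cases p) (auto simp: simple_path_Cons)
qed simp

text \<open>A common neighbour \<open>u\<close> outside both paths would join the reversed first
  path to the second one, giving more than \<open>k\<close> vertices.\<close>

lemma no_linked_across_edge:
  assumes "linked E x y p q" "x \<in> V" "y \<in> V" "k \<le> length (x # p) + length (y # q)"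
    "(x, u) \<in> E" "(y, u) \<in> E"
  shows "u \<in> set (x # p) \<union> set (y # q)"
proof (rule ccontr)
  assume u: "\<not> ?thesis"
  have "simple_path E (u # y # q)"
    using assms(1,6) u sym by (auto simp: linked_def simple_path_Cons dest: symD)
  moreover have "simple_path E (rev (x # p))"
    using assms(1) by (subst simple_path_rev[OF sym]) (simp add: linked_def)
  moreover have "set (rev (x # p)) \<inter> set (u # y # q) = {}"
    using assms(1) u by (auto simp: linked_def)
  ultimately have sp: "simple_path E (rev (x # p) @ u # y # q)"
    unfolding simple_path_append using assms(5) by simp
  have "set (x # p) \<subseteq> V" "set (y # q) \<subseteq> V" "u \<in> V"
    using path_in_V[of "x # p"] path_in_V[of "y # q"] assms edges by (auto simp: linked_def)
  then have "length (rev (x # p) @ u # y # q) < k" by (intro no_path[OF sp]) auto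
  then show False using assms(4) by simp
qed

text \<open>Connectivity yields a path between the two paths. On each side
  \<open>path_ending_at\<close> prolongs it by more vertices than the end has neighbours there,
  hence the \<open>+ 2\<close>.\<close>

lemma no_two_short_sides:
  assumes l: "linked E x y p q" and V: "x \<in> V" "y \<in> V"
    and k: "k \<le> card {v \<in> set (x # p). (x, v) \<in> E} + card {v \<in> set (y # q). (y, v) \<in> E} + 2"
  shows False
proof -
  have sp: "simple_path E (x # p)" "simple_path E (y # q)" "set (x # p) \<inter> set (y # q) = {}"
    using l by (auto simp: linked_def)
  have inV: "set (x # p) \<subseteq> V" "set (y # q) \<subseteq> V"
    using path_in_V[OF sp(1)] path_in_V[OF sp(2)] V by auto
  obtain c d r where c: "c \<in> set (x # p)" "d \<in> set (y # q)" "simple_path E (c # r @ [d])"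
      "set r \<inter> (set (x # p) \<union> set (y # q)) = {}"
    using connecting_path[OF _ _ sp(3) connected[OF V]] by (metis list.set_intros(1))
  obtain u where u: "simple_path E u" "u \<noteq> []" "last u = c" "set u \<subseteq> set (x # p)"
      "card {v \<in> set (x # p). (x, v) \<in> E} < length u"
    using path_ending_at[OF sp(1) _ _ c(1) sym irrefl, of x] by auto
  obtain w where w: "simple_path E w" "w \<noteq> []" "last w = d" "set w \<subseteq> set (y # q)"
      "card {v \<in> set (y # q). (y, v) \<in> E} < length w"
    using path_ending_at[OF sp(2) _ _ c(2) sym irrefl, of y] by auto
  have rw: "simple_path E (rev w)" "hd (rev w) = d" using w simple_path_rev[OF sym] by (auto simp: hd_rev)
  have r: "simple_path E r" "r = [] \<Longrightarrow> (c, d) \<in> E" "r \<noteq> [] \<Longrightarrow> (c, hd r) \<in> E \<and> (last r, d) \<in> E"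
    using c(3) by (auto simp: simple_path_Cons simple_path_append)
  have "simple_path E (r @ rev w)"
    unfolding simple_path_append using r rw w(4) c(4) by auto
  moreover have "(c, hd (r @ rev w)) \<in> E" using r rw w(2) by (cases r) auto
  moreover have "set u \<inter> set (r @ rev w) = {}" using u(4) w(4) c(4) sp(3) by auto
  ultimately have sp: "simple_path E (u @ r @ rev w)"
    unfolding simple_path_append[of E u] using u by simp
  have "set (u @ r @ rev w) \<subseteq> V"
    using path_in_V[OF sp] u(2,4) inV by (metis Nil_is_append_conv hd_append2 hd_in_set subsetD)
  then have "length (u @ r @ rev w) < k" by (rule no_path[OF sp])
  then show False using u(5) w(5) k by simp
qed

text \<open>In the cone, the two paths and \<open>None\<close> form one path from \<open>x\<close>
  to \<open>y\<close>, to which \<open>crossing_cycle\<close> applies. \<open>None\<close> adds one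
  to the degree of both ends, so the cycle has at least \<open>k + 1\<close> vertices and leaves a
  path on at least \<open>k\<close>.\<close>

lemma no_crossing:
  assumes l: "linked E x y p q" and V: "x \<in> V" "y \<in> V" and nadj: "(x, y) \<notin> E"
    and k: "k \<le> length (x # p) + length (y # q)"
    and W: "W = set (x # p) \<union> set (y # q)"
    and deg: "k \<le> card {v \<in> W. (x, v) \<in> E} + card {v \<in> W. (y, v) \<in> E} + 1"
    and crossing: "(\<exists>v\<in>set (y # q). (x, v) \<in> E) \<or> (\<exists>v\<in>set (x # p). (y, v) \<in> E)"
  shows False
proof -
  let ?R = "cone V E"
  let ?X = "map Some (x # p)" and ?Y = "rev (map Some (y # q))"
  define Z where "Z = ?X @ None # ?Y"
  define N where "N = (\<lambda>z. {i. i < length Z \<and> (z, Z ! i) \<in> ?R})"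
  have sp: "simple_path E (x # p)" "simple_path E (y # q)" "set (x # p) \<inter> set (y # q) = {}"
    using l by (auto simp: linked_def)
  have inV: "set (x # p) \<subseteq> V" "set (y # q) \<subseteq> V"
    using path_in_V[OF sp(1)] path_in_V[OF sp(2)] V by auto
  have "simple_path E (rev (y # q))" using sp(2) simple_path_rev[OF sym] by blast
  then have Y: "simple_path ?R ?Y" unfolding rev_map simple_path_cone_Some .
  have "hd ?Y \<in> set ?Y" by (rule hd_in_set) simp
  then have hY: "hd ?Y \<in> Some ` V" using inV(2) by auto
  have "last ?X \<in> set ?X" by (rule last_in_set) simp
  then have lX: "last ?X \<in> Some ` V" using inV(1) by auto
  have "simple_path ?R (None # ?Y)"
    unfolding simple_path_Cons using Y hY by auto
  moreover have "simple_path ?R ?X" unfolding simple_path_cone_Some by (rule sp(1))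
  moreover have "set ?X \<inter> set (None # ?Y) = {}" using sp(3) by auto
  moreover have "(last ?X, hd (None # ?Y)) \<in> ?R" using lX by auto
  ultimately have Z: "simple_path ?R Z"
    unfolding Z_def simple_path_append[of ?R ?X] by blast
  have Z0: "Z ! 0 = Some x" by (simp add: Z_def)
  have Zl: "Z ! (length Z - 1) = Some y"
    unfolding Z_def by (simp add: nth_append)
  have lenZ: "length Z = length (x # p) + length (y # q) + 1" by (simp add: Z_def)
  have setZ: "set Z = insert None (Some ` W)" by (auto simp: Z_def W)
  have cardN: "card (N (Some v)) = Suc (card {u \<in> W. (v, u) \<in> E})" if "v \<in> V" for v
  proof -
    have "distinct Z" using Z by (simp add: simple_path_def)
    then have "inj_on ((!) Z) (N (Some v))" by (auto simp: N_def inj_on_def nth_eq_iff_index_eq)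
    then have "card (N (Some v)) = card ((!) Z ` N (Some v))" by (simp add: card_image)
    also have "(!) Z ` N (Some v) = {z \<in> set Z. (Some v, z) \<in> ?R}"
      unfolding N_def by (auto simp: in_set_conv_nth)
    also have "\<dots> = insert None (Some ` {u \<in> W. (v, u) \<in> E})" using that setZ by auto
    also have "card \<dots> = Suc (card {u \<in> W. (v, u) \<in> E})"
      by (simp add: W card_insert_if card_image)
    finally show ?thesis .
  qed
  have mid: "length ?X \<in> N (Some v)" if "v \<in> V" for v
    using that unfolding N_def Z_def by (simp add: nth_append)
  \<comment> \<open>\<open>None\<close> has index \<open>length ?X\<close> and is a neighbour of
    both ends, so it supplies one half of the crossing pair in either case.\<close>
  have "\<exists>a b. a < b \<and> a \<in> N (Some y) \<and> b \<in> N (Some x)"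
  proof (cases "\<exists>v\<in>set (y # q). (x, v) \<in> E")
    case True
    then obtain v where "v \<in> set (y # q)" "(x, v) \<in> E" by blast
    then have "Some v \<in> set ?Y" by auto
    then obtain i where i: "i < length ?Y" "?Y ! i = Some v" by (meson in_set_conv_nth)
    have "Z ! (length ?X + Suc i) = Some v" "length ?X + Suc i < length Z"
      using i by (simp_all add: Z_def nth_append)
    then have "length ?X + Suc i \<in> N (Some x)" using \<open>(x, v) \<in> E\<close> by (simp add: N_def)
    then show ?thesis using mid[OF V(2)]
      by (intro exI[of _ "length ?X"] exI[of _ "length ?X + Suc i"]) simp
  next
    case False
    then obtain v where "v \<in> set (x # p)" "(y, v) \<in> E" using crossing by blast
    then have "Some v \<in> set ?X" by auto
    then obtain i where i: "i < length ?X" "?X ! i = Some v" by (meson in_set_conv_nth)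
    have "Z ! i = Some v" "i < length Z" using i unfolding Z_def nth_append by auto
    then have "i \<in> N (Some y)" using \<open>(y, v) \<in> E\<close> by (simp add: N_def)
    then show ?thesis using mid[OF V(1)] i(1) by blast
  qed
  then obtain a b where ab: "a < b" "a \<in> N (Some y)" "b \<in> N (Some x)" by blast
  obtain C where C: "C \<noteq> []" "simple_path ?R C" "(last C, hd C) \<in> ?R" "set C \<subseteq> set Z"
      "min (length Z) (card (N (Some x)) + card (N (Some y))) \<le> length C"
    using crossing_cycle[OF Z sym_cone[OF sym] irrefl_cone[OF irrefl] _ _ _ ab]
      nadj unfolding Z0 Zl N_def by auto
  obtain r where r: "simple_path E r" "Some ` set r \<subseteq> set C" "length C \<le> Suc (length r)"
    using cycle_cone_imp_path[OF C(1-3)] by blast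
  have "W \<subseteq> V" using inV W by auto
  moreover have "v \<in> W" if "v \<in> set r" for v
    using subsetD[OF order_trans[OF r(2) C(4)], of "Some v"] that setZ by auto
  ultimately have "set r \<subseteq> V" by blast
  then have "length r < k" using no_path r(1) by blast
  moreover have "Suc k \<le> length C"
    using C(5) lenZ k deg cardN[OF V(1)] cardN[OF V(2)] by linarith
  ultimately show False using r(3) by simp
qed

text \<open>The pair of disjoint paths provided by maximality is chosen as long as possible among all
  non-adjacent pairs in \<open>A \<times> B\<close>; then all neighbours in \<open>A\<close> and \<open>B\<close> of its ends lie on it.\<close>

lemma adjacentI:
  assumes AB: "A \<subseteq> V" "B \<subseteq> V"
    and degA: "\<And>v. v \<in> A \<Longrightarrow> a \<le> card {u \<in> A. (v, u) \<in> E}"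
    and degB: "\<And>v. v \<in> B \<Longrightarrow> b \<le> card {u \<in> B. (v, u) \<in> E}"
    and k: "k \<le> a + b + 1"
    and xy0: "x0 \<in> A" "y0 \<in> B" "x0 \<noteq> y0"
  shows "(x0, y0) \<in> E"
proof (rule ccontr)
  assume nadj: "(x0, y0) \<notin> E"
  define P where "P = (\<lambda>(x, y, p, q). x \<in> A \<and> y \<in> B \<and> x \<noteq> y \<and> (x, y) \<notin> E \<and> linked E x y p q)"
  define m where "m = (\<lambda>(x :: 'a, y :: 'a, p :: 'a list, q :: 'a list). length (x # p) + length (y # q))"
  obtain p0 q0 where pq0: "linked E x0 y0 p0 q0" "k \<le> length (x0 # p0) + length (y0 # q0)"
    using maximal[of x0 y0] xy0 AB nadj by blast
  have P0: "P (x0, y0, p0, q0)" using pq0 xy0 nadj by (simp add: P_def)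
  have bound: "m z \<le> card V + card V" if "P z" for z
  proof -
    obtain x y p q where z: "z = (x, y, p, q)" by (metis prod_cases4)
    have sp: "simple_path E (x # p)" "simple_path E (y # q)" "x \<in> V" "y \<in> V"
      using that AB by (auto simp: z P_def linked_def)
    have "length r \<le> card V" if "simple_path E r" "r \<noteq> []" "hd r \<in> V" for r
      using that path_in_V[OF that] finite_V
      by (metis card_mono distinct_card simple_path_def)
    then have "length (x # p) \<le> card V" "length (y # q) \<le> card V"
      using sp by (metis list.distinct(1) list.sel(1))+
    then show ?thesis by (simp add: z m_def)
  qed
  have "\<exists>z. P z \<and> (\<forall>z'. P z' \<longrightarrow> m z' \<le> m z)"
    by (rule ex_has_greatest_nat[of P "(x0, y0, p0, q0)" m "Suc (card V + card V)"])
      (use P0 bound in \<open>auto simp: less_Suc_eq_le\<close>)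
  then obtain z where z: "P z" and max: "\<And>z'. P z' \<Longrightarrow> m z' \<le> m z"
    by blast
  obtain x y p q where z_eq: "z = (x, y, p, q)" by (metis prod_cases4)
  have xy: "x \<in> A" "y \<in> B" "x \<noteq> y" "(x, y) \<notin> E" and l: "linked E x y p q"
    using z by (auto simp: P_def z_eq)
  have V: "x \<in> V" "y \<in> V" using xy AB by auto
  have len: "k \<le> length (x # p) + length (y # q)"
    using max[OF P0] pq0(2) by (simp add: m_def z_eq)
  let ?W = "set (x # p) \<union> set (y # q)"
  \<comment> \<open>By \<open>no_linked_across_edge\<close>, \<open>u\<close> is not adjacent to
    \<open>y\<close>. So \<open>u\<close> and \<open>y\<close>, with the first path prolonged to
    start at \<open>u\<close>, would be a longer admissible pair.\<close>
  have nbA: "u \<in> ?W" if "u \<in> A" "(x, u) \<in> E" for u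
  proof (rule ccontr)
    assume u: "u \<notin> ?W"
    have "(y, u) \<notin> E" using no_linked_across_edge[OF l V len that(2)] u by blast
    then have "(u, y) \<notin> E" using sym by (auto dest: symD)
    moreover have "linked E u y (x # p) q"
      using l u that(2) sym by (auto simp: linked_def simple_path_Cons dest: symD)
    ultimately have "P (u, y, x # p, q)" using that xy u by (auto simp: P_def)
    then show False using max by (fastforce simp: m_def z_eq)
  qed
  have nbB: "u \<in> ?W" if "u \<in> B" "(y, u) \<in> E" for u
  proof (rule ccontr)
    assume u: "u \<notin> ?W"
    have "(x, u) \<notin> E" using no_linked_across_edge[OF l V len _ that(2)] u by blast
    moreover have "linked E x u p (y # q)"
      using l u that(2) sym by (auto simp: linked_def simple_path_Cons dest: symD)
    ultimately have "P (x, u, p, y # q)" using that xy u by (auto simp: P_def)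
    then show False using max by (fastforce simp: m_def z_eq)
  qed
  \<comment> \<open>If an end has a neighbour on the opposite path, the cycle exchange applies;
    otherwise each end has its neighbours on its own path and connectivity gives the
    contradiction.\<close>
  show False
  proof (cases "(\<exists>v\<in>set (y # q). (x, v) \<in> E) \<or> (\<exists>v\<in>set (x # p). (y, v) \<in> E)")
    case True
    have "a \<le> card {v \<in> ?W. (x, v) \<in> E}"
      by (rule order_trans[OF degA[OF xy(1)]]) (auto intro!: card_mono dest: nbA)
    moreover have "b \<le> card {v \<in> ?W. (y, v) \<in> E}"
      by (rule order_trans[OF degB[OF xy(2)]]) (auto intro!: card_mono dest: nbB)
    ultimately show False
      using no_crossing[OF l V xy(4) len refl _ True] k by linarith
  next
    case False
    have "a \<le> card {v \<in> set (x # p). (x, v) \<in> E}"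
      using nbA False by (intro order_trans[OF degA[OF xy(1)]] card_mono) auto
    moreover have "b \<le> card {v \<in> set (y # q). (y, v) \<in> E}"
      using nbB False by (intro order_trans[OF degB[OF xy(2)]] card_mono) auto
    ultimately show False
      using no_two_short_sides[OF l V] k by linarith
  qed
qed

end

section \<open>Counting complete bipartite subgraphs\<close>

text \<open>A value above \<open>f r\<close> forces an increase somewhere before \<open>a\<close>;
  by convexity the increments stay positive up to \<open>h\<close>, so \<open>f h\<close> is at
  least \<open>f a\<close>.\<close>

lemma discrete_convex_le_max:
  fixes f :: "nat \<Rightarrow> real"
  assumes convex: "\<And>a. r \<le> a \<Longrightarrow> a + 2 \<le> h \<Longrightarrow> f (a + 1) - f a \<le> f (a + 2) - f (a + 1)"
    and "r \<le> a" "a \<le> h"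
  shows "f a \<le> max (f r) (f h)"
proof (rule ccontr)
  assume less: "\<not> ?thesis"
  have mono: "f (i + 1) - f i \<le> f (j + 1) - f j" if "i \<le> j" "r \<le> i" "j < h" for i j
    using that
  proof (induction j rule: dec_induct)
    case (step j)
    then show ?case using convex[of j] by simp
  qed simp
  have "\<exists>i. r \<le> i \<and> i < a \<and> f i < f (i + 1)"
  proof (rule ccontr)
    assume neg: "\<not> ?thesis"
    have "f j \<le> f r" if "r \<le> j" "j \<le> a" for j
      using that
    proof (induction j rule: dec_induct)
      case (step j)
      then have "\<not> f j < f (j + 1)" using neg by auto
      then show ?case using step by simp
    qed simp
    then show False using less assms(2) by force
  qed
  then obtain i where i: "r \<le> i" "i < a" "f i < f (i + 1)" by blast
  have "f a \<le> f j" if "a \<le> j" "j \<le> h" for j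
    using that
  proof (induction j rule: dec_induct)
    case (step j)
    then show ?case using mono[of i j] i by simp
  qed simp
  then show False using less assms(3) by force
qed

text \<open>The upper argument must not be truncated at \<open>0\<close>, since \<open>0 choose 0 = 1\<close>.\<close>

definition diff_choose :: "nat \<Rightarrow> nat \<Rightarrow> nat \<Rightarrow> nat" where
  "diff_choose m i j = (if i \<le> m then (m - i) choose j else 0)"

lemma diff_choose_mono: "m \<le> m' \<Longrightarrow> diff_choose m i j \<le> diff_choose m' i j"
  by (simp add: diff_choose_def binomial_right_mono)

text \<open>The number of pairs spanning a \<open>K\<^sub>s\<^sub>,\<^sub>t\<close> in the join of a complete graph on \<open>a\<close> vertices with
  the disjoint union of a complete graph on \<open>c - 2 * a\<close> and an empty graph on the remaining
  \<open>n - c + a\<close> vertices.\<close>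

definition labelled_count :: "nat \<Rightarrow> nat \<Rightarrow> nat \<Rightarrow> nat \<Rightarrow> nat \<Rightarrow> nat" where
  "labelled_count s t n c a =
     (\<Sum>j = c - a..<n. (a choose s) * diff_choose j s (t - 1) + (a choose t) * diff_choose j t (s - 1))
     + ((c - a) choose (s + t)) * ((s + t) choose s)"

text \<open>The part of the forward difference of \<open>labelled_count\<close> at \<open>a\<close>
  belonging to one orientation of the sides, with \<open>m\<close> standing for
  \<open>c - a - 1\<close>.\<close>

definition side_growth :: "nat \<Rightarrow> nat \<Rightarrow> nat \<Rightarrow> nat \<Rightarrow> nat \<Rightarrow> real" where
  "side_growth s t n m a =
     real (a choose (s - 1)) * (\<Sum>j = Suc m..<n. real (diff_choose j s (t - 1)))
     - (real (m choose s) - real (Suc a choose s)) * real (diff_choose m s (t - 1))"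

lemma choose_add_mult:
  "(m choose (s + u)) * ((s + u) choose s) = (m choose s) * diff_choose m s u"
proof (cases "s + u \<le> m")
  case True
  then show ?thesis
    using choose_mult[of s "s + u" m] by (simp add: diff_choose_def)
next
  case False
  then show ?thesis by (simp add: diff_choose_def binomial_eq_0)
qed

text \<open>Both sides count pairs of disjoint sets of sizes \<open>s\<close> and \<open>t\<close>
  in \<open>Suc m\<close> points; on the right, a fixed point lies in neither set, in the second or
  in the first.\<close>

lemma Suc_choose_add_mult:
  assumes "s \<ge> 1" "t \<ge> 1"
  shows "(Suc m choose (s + t)) * ((s + t) choose s) =
    (m choose (s + t)) * ((s + t) choose s)
      + (m choose s) * diff_choose m s (t - 1) + (m choose t) * diff_choose m t (s - 1)"
proof -
  obtain s' t' where st: "s = Suc s'" "t = Suc t'"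
    using assms by (metis One_nat_def Suc_le_D)
  have flip: "m choose (s + t') = m choose (t + s')" by (simp add: st add.commute)
  have "(s + t) choose s = (s + t' choose s) + (s + t' choose s')" by (simp add: st)
  also have "(s + t') choose s' = (t + s') choose t"
    using binomial_symmetric[of s' "s + t'"] by (simp add: st add.commute)
  finally have "(m choose (t + s')) * ((s + t) choose s) =
      (m choose (s + t')) * ((s + t') choose s) + (m choose (t + s')) * ((t + s') choose t)"
    by (simp only: add_mult_distrib2 flip)
  then have "(m choose (t + s')) * ((s + t) choose s) =
      (m choose s) * diff_choose m s t' + (m choose t) * diff_choose m t s'"
    unfolding choose_add_mult .
  moreover have "Suc m choose (s + t) = (m choose (t + s')) + (m choose (s + t))"
    by (simp add: st add.commute)
  ultimately show ?thesis by (simp add: st add_mult_distrib)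
qed

text \<open>From \<open>a\<close> to \<open>Suc a\<close> the sum gains the term
  \<open>j = m\<close>, while the clique shrinks from \<open>Suc m\<close> to \<open>m\<close>
  vertices; \<open>Suc_choose_add_mult\<close> evaluates that loss.\<close>

lemma labelled_count_diff:
  assumes st: "s \<ge> 1" "t \<ge> 1" and m: "c - a = Suc m" "Suc m \<le> n"
  shows "real (labelled_count s t n c (Suc a)) - real (labelled_count s t n c a)
    = side_growth s t n m a + side_growth t s n m a"
proof -
  have m': "c - Suc a = m" using m by simp
  have split: "(\<Sum>j = m..<n. f j) = f m + (\<Sum>j = Suc m..<n. f j)" for f :: "nat \<Rightarrow> real"
    using m by (simp add: sum.atLeast_Suc_lessThan)
  have pascal: "real (Suc a choose i) = real (a choose i) + real (a choose (i - 1))" if "i \<ge> 1" for i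
    using that by (cases i) auto
  have id: "real (Suc m choose (s + t)) * real ((s + t) choose s) =
     real (m choose (s + t)) * real ((s + t) choose s)
      + real (m choose s) * real (diff_choose m s (t - 1))
      + real (m choose t) * real (diff_choose m t (s - 1))"
    using arg_cong[OF Suc_choose_add_mult[OF st, of m], of real]
    by (simp only: of_nat_add of_nat_mult)
  show ?thesis
    unfolding labelled_count_def side_growth_def m m' of_nat_add of_nat_mult of_nat_sum
      sum.distrib sum_distrib_left[symmetric] split id
    unfolding pascal[OF st(1)] pascal[OF st(2)]
    by (simp add: algebra_simps)
qed

text \<open>When \<open>a\<close> rises, \<open>m\<close> falls: the first product grows and the
  subtracted one shrinks. \<open>a + 2 \<le> m\<close> makes the first factor of the larger
  subtracted product non-negative.\<close>

lemma side_growth_mono: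
  assumes "a + 2 \<le> m"
  shows "side_growth s t n (Suc m) a \<le> side_growth s t n m (Suc a)"
proof -
  have "real (a choose (s - 1)) * (\<Sum>j = Suc (Suc m)..<n. real (diff_choose j s (t - 1)))
    \<le> real (Suc a choose (s - 1)) * (\<Sum>j = Suc m..<n. real (diff_choose j s (t - 1)))"
    by (intro mult_mono sum_mono2 sum_nonneg) (auto intro: binomial_right_mono)
  moreover have "(real (m choose s) - real (Suc (Suc a) choose s)) * real (diff_choose m s (t - 1))
    \<le> (real (Suc m choose s) - real (Suc a choose s)) * real (diff_choose (Suc m) s (t - 1))"
  proof (intro mult_mono)
    show "real (m choose s) - real (Suc (Suc a) choose s) \<le> real (Suc m choose s) - real (Suc a choose s)"
      by (intro diff_mono) (auto intro: binomial_right_mono)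
    have "Suc a choose s \<le> Suc m choose s" using assms by (intro binomial_right_mono) auto
    then show "0 \<le> real (Suc m choose s) - real (Suc a choose s)" by simp
  qed (auto intro: diff_choose_mono)
  ultimately show ?thesis unfolding side_growth_def by linarith
qed

lemma labelled_count_le_max:
  assumes st: "s \<ge> 1" "t \<ge> 1" and "2 * h < c" "c \<le> n" "r \<le> a" "a \<le> h"
  shows "real (labelled_count s t n c a) \<le>
    max (real (labelled_count s t n c r)) (real (labelled_count s t n c h))"
proof (rule discrete_convex_le_max[OF _ assms(5,6)])
  fix a assume a: "r \<le> a" "a + 2 \<le> h"
  \<comment> \<open>With this offset the consecutive differences are the \<open>side_growth\<close>
    sums at \<open>(Suc m, a)\<close> and \<open>(m, Suc a)\<close>.\<close>
  define m where "m = c - a - 2"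
  have m: "c - a = Suc (Suc m)" "c - Suc a = Suc m" "a + 2 \<le> m" "Suc (Suc m) \<le> n"
    using assms a by (auto simp: m_def)
  show "real (labelled_count s t n c (a + 1)) - real (labelled_count s t n c a)
    \<le> real (labelled_count s t n c (a + 2)) - real (labelled_count s t n c (a + 1))"
    using labelled_count_diff[OF st m(1,4)] labelled_count_diff[OF st m(2)] m(4)
      side_growth_mono[OF m(3), of s t n] side_growth_mono[OF m(3), of t s n] by simp
qed

section \<open>Counting ordered bicliques by deleting vertices\<close>

definition bicliques :: "nat \<Rightarrow> nat \<Rightarrow> 'a set \<Rightarrow> ('a \<times> 'a) set \<Rightarrow> ('a set \<times> 'a set) set" where
  "bicliques s t V E =
     {(S, T). S \<subseteq> V \<and> T \<subseteq> V \<and> S \<inter> T = {} \<and> card S = s \<and> card T = t \<and> S \<times> T \<subseteq> E}"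

lemma finite_bicliques: "finite V \<Longrightarrow> finite (bicliques s t V E)"
  by (rule finite_subset[of _ "Pow V \<times> Pow V"]) (auto simp: bicliques_def)

text \<open>A pair is determined by its union and the choice of the first side in it.\<close>

lemma card_bicliques_le:
  assumes "finite V"
  shows "card (bicliques s t V E) \<le> (card V choose (s + t)) * ((s + t) choose s)"
proof -
  let ?U = "{U. U \<subseteq> V \<and> card U = s + t}"
  let ?P = "SIGMA U:?U. {S. S \<subseteq> U \<and> card S = s}"
  have finU: "finite U" if "U \<in> ?U" for U
    using that assms by (auto intro: finite_subset)
  have finS: "finite {S. S \<subseteq> U \<and> card S = s}" if "U \<in> ?U" for U
    using finU[OF that] by simp
  have fin: "finite ?U" using assms by simp
  have "bicliques s t V E \<subseteq> (\<lambda>(U, S). (S, U - S)) ` ?P"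
  proof
    fix z assume "z \<in> bicliques s t V E"
    then obtain S T where z: "z = (S, T)" "S \<subseteq> V" "T \<subseteq> V" "S \<inter> T = {}" "card S = s" "card T = t"
      by (auto simp: bicliques_def)
    then have "card (S \<union> T) = s + t"
      using assms by (simp add: card_Un_disjoint finite_subset)
    then have "(S \<union> T, S) \<in> ?P" using z by auto
    moreover have "z = (\<lambda>(U, S). (S, U - S)) (S \<union> T, S)" using z(1,4) by auto
    ultimately show "z \<in> (\<lambda>(U, S). (S, U - S)) ` ?P" by (rule image_eqI[rotated])
  qed
  moreover have finP: "finite ?P" by (rule finite_SigmaI[OF fin finS])
  ultimately have "card (bicliques s t V E) \<le> card ?P" by (intro surj_card_le[OF finP])
  also have "\<dots> = (\<Sum>U\<in>?U. card {S. S \<subseteq> U \<and> card S = s})"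
    by (rule card_SigmaI) (use fin finS in blast)+
  also have "\<dots> = (\<Sum>U\<in>?U. (s + t) choose s)"
    using finU by (intro sum.cong) (auto simp: n_subsets)
  also have "\<dots> = (card V choose (s + t)) * ((s + t) choose s)"
    using assms by (simp add: n_subsets)
  finally show ?thesis .
qed

text \<open>The side \<open>S\<close> lies among the at most \<open>d\<close> neighbours of
  \<open>v\<close>, and the rest of \<open>T\<close> avoids \<open>S\<close> and
  \<open>v\<close>.\<close>

lemma card_bicliques_through_le:
  assumes "finite V" "v \<in> V" "sym E" "irrefl E" "t \<ge> 1" "card {u \<in> V. (v, u) \<in> E} \<le> d"
  shows "card {(S, T) \<in> bicliques s t V E. v \<in> T} \<le> (d choose s) * diff_choose (card V - 1) s (t - 1)"
proof -
  let ?N = "{u \<in> V. (v, u) \<in> E}"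
  let ?A = "{S. S \<subseteq> ?N \<and> card S = s}"
  let ?B = "\<lambda>S. {T. T \<subseteq> V - {v} - S \<and> card T = t - 1}"
  have N: "?N \<subseteq> V - {v}" using assms(4) by (auto simp: irrefl_def)
  have finA: "finite ?A" using assms(1) by simp
  have finB: "finite (?B S)" for S using assms(1) by simp
  have "{(S, T) \<in> bicliques s t V E. v \<in> T} \<subseteq> (\<lambda>(S, T). (S, insert v T)) ` Sigma ?A ?B"
  proof
    fix z assume "z \<in> {(S, T) \<in> bicliques s t V E. v \<in> T}"
    then obtain S T where z: "z = (S, T)" "S \<subseteq> V" "T \<subseteq> V" "S \<inter> T = {}" "card S = s" "card T = t"
        "S \<times> T \<subseteq> E" "v \<in> T"
      by (auto simp: bicliques_def)
    have "(S, T - {v}) \<in> Sigma ?A ?B"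
      using z assms(1,3) by (auto dest: symD)
    moreover have "z = (\<lambda>(S, T). (S, insert v T)) (S, T - {v})" using z by auto
    ultimately show "z \<in> (\<lambda>(S, T). (S, insert v T)) ` Sigma ?A ?B" by (rule image_eqI[rotated])
  qed
  moreover have finAB: "finite (Sigma ?A ?B)" using finA finB by (intro finite_SigmaI)
  ultimately have "card {(S, T) \<in> bicliques s t V E. v \<in> T} \<le> card (Sigma ?A ?B)"
    by (intro surj_card_le[OF finAB])
  also have "\<dots> = (\<Sum>S\<in>?A. card (?B S))"
    using finA finB by (intro card_SigmaI) auto
  also have "\<dots> = (\<Sum>S\<in>?A. diff_choose (card V - 1) s (t - 1))"
  proof (intro sum.cong refl)
    fix S assume S: "S \<in> ?A"
    then have sub: "S \<subseteq> V - {v}" "finite S"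
      using N assms(1) by (auto intro: finite_subset[of S V])
    have "card (V - {v}) = card V - 1" using assms(1,2) by simp
    then have "s \<le> card V - 1" "card (V - {v} - S) = card V - 1 - s"
      using S sub assms(1) card_mono[of "V - {v}" S] by (auto simp: card_Diff_subset)
    then show "card (?B S) = diff_choose (card V - 1) s (t - 1)"
      using assms(1) by (simp add: n_subsets diff_choose_def)
  qed
  also have "\<dots> = (card ?N choose s) * diff_choose (card V - 1) s (t - 1)"
    using assms(1) by (simp add: n_subsets)
  also have "\<dots> \<le> (d choose s) * diff_choose (card V - 1) s (t - 1)"
    using assms(6) by (intro mult_right_mono binomial_right_mono) auto
  finally show ?thesis .
qed

lemma card_bicliques_swap_le:
  assumes "finite V" "sym E"
  shows "card {(S, T) \<in> bicliques s t V E. v \<in> S} \<le> card {(S, T) \<in> bicliques t s V E. v \<in> T}"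
proof (rule surj_card_le)
  show "finite {(S, T) \<in> bicliques t s V E. v \<in> T}"
    by (rule finite_subset[OF _ finite_bicliques[OF assms(1), of t s E]]) auto
  show "{(S, T) \<in> bicliques s t V E. v \<in> S} \<subseteq> prod.swap ` {(S, T) \<in> bicliques t s V E. v \<in> T}"
    using assms(2) by (force simp: bicliques_def image_iff dest: symD)
qed

text \<open>The \<open>(d + 1)\<close>-core, left after repeatedly deleting vertices of degree at
  most \<open>d\<close>; the union avoids fixing an order of deletion.\<close>

definition core :: "nat \<Rightarrow> 'a set \<Rightarrow> ('a \<times> 'a) set \<Rightarrow> 'a set" where
  "core d V E = \<Union>{U. U \<subseteq> V \<and> (\<forall>v\<in>U. d < card {u \<in> U. (v, u) \<in> E})}"

lemma core_subset: "core d V E \<subseteq> V"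
  by (auto simp: core_def)

lemma core_upper: "U \<subseteq> V \<Longrightarrow> (\<And>v. v \<in> U \<Longrightarrow> d < card {u \<in> U. (v, u) \<in> E}) \<Longrightarrow> U \<subseteq> core d V E"
  by (auto simp: core_def)

lemma core_degree:
  assumes "finite V" "v \<in> core d V E"
  shows "d < card {u \<in> core d V E. (v, u) \<in> E}"
proof -
  obtain U where U: "U \<subseteq> V" "\<forall>v\<in>U. d < card {u \<in> U. (v, u) \<in> E}" "v \<in> U"
    using assms(2) by (auto simp: core_def)
  have "U \<subseteq> core d V E" using U by (intro core_upper) auto
  moreover have "finite (core d V E)" using assms(1) core_subset finite_subset by metis
  ultimately have "card {u \<in> U. (v, u) \<in> E} \<le> card {u \<in> core d V E. (v, u) \<in> E}"
    by (intro card_mono) auto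
  then show ?thesis using U by force
qed

text \<open>While more than \<open>m\<close> vertices are left, some vertex lies outside the core
  and one of degree at most \<open>d\<close> exists. Deleting it destroys at most the
  \<open>j\<close>-th summand, \<open>j\<close> being the number of vertices left afterwards. The
  last \<open>m\<close> vertices are counted as if complete.\<close>

lemma card_bicliques_peel:
  assumes st: "s \<ge> 1" "t \<ge> 1" and E: "sym E" "irrefl E"
    and "finite V" "card (core d V E) \<le> m" "m \<le> card V"
  shows "card (bicliques s t V E) \<le>
    (\<Sum>j = m..<card V. (d choose s) * diff_choose j s (t - 1) + (d choose t) * diff_choose j t (s - 1))
     + (m choose (s + t)) * ((s + t) choose s)"
  using assms(5-7)
proof (induction "card V" arbitrary: V)
  case 0
  then show ?case using card_bicliques_le[of V s t E] by simp
next
  case (Suc k)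
  show ?case
  proof (cases "m = card V")
    case True
    then show ?thesis using card_bicliques_le[of V s t E] Suc.prems by simp
  next
    case False
    then have lt: "m < card V" using Suc.prems by simp
    have "\<not> V \<subseteq> core d V E"
    proof
      assume "V \<subseteq> core d V E"
      then have "core d V E = V" by (intro equalityI core_subset)
      then show False using lt Suc.prems by simp
    qed
    then obtain v where v: "v \<in> V" "card {u \<in> V. (v, u) \<in> E} \<le> d"
      using core_upper[of V V d E] by (meson not_less subset_refl)
    have k: "card (V - {v}) = k" using Suc v by simp
    have "core d (V - {v}) E \<subseteq> core d V E" unfolding core_def by blast
    moreover have "finite (core d V E)" using Suc.prems(1) core_subset finite_subset by metis
    ultimately have "card (core d (V - {v}) E) \<le> m"
      using Suc.prems(2) card_mono le_trans by blast
    then have IH: "card (bicliques s t (V - {v}) E) \<le>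
        (\<Sum>j = m..<k. (d choose s) * diff_choose j s (t - 1) + (d choose t) * diff_choose j t (s - 1))
        + (m choose (s + t)) * ((s + t) choose s)"
      using Suc.hyps(1)[of "V - {v}"] k Suc lt by simp
    let ?R = "{(S, T) \<in> bicliques s t V E. v \<in> T}" and ?L = "{(S, T) \<in> bicliques s t V E. v \<in> S}"
    have "bicliques s t V E \<subseteq> bicliques s t (V - {v}) E \<union> (?R \<union> ?L)"
      by (auto simp: bicliques_def)
    moreover have "finite (bicliques s t (V - {v}) E \<union> (?R \<union> ?L))"
      using finite_bicliques[of V s t E] finite_bicliques[of "V - {v}" s t E] Suc.prems(1)
      by (auto intro: finite_subset[of _ "bicliques s t V E"])
    ultimately have "card (bicliques s t V E) \<le> card (bicliques s t (V - {v}) E \<union> (?R \<union> ?L))"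
      by (rule card_mono[rotated])
    also have "\<dots> \<le> card (bicliques s t (V - {v}) E) + (card ?R + card ?L)"
      by (meson add_left_mono card_Un_le le_trans)
    also have "card ?R \<le> (d choose s) * diff_choose k s (t - 1)"
      using card_bicliques_through_le[OF Suc.prems(1) v(1) E st(2) v(2), of s]
      by (simp flip: Suc.hyps(2))
    also have "card ?L \<le> (d choose t) * diff_choose k t (s - 1)"
      using card_bicliques_through_le[OF Suc.prems(1) v(1) E st(1) v(2), of t]
        card_bicliques_swap_le[OF Suc.prems(1) E(1), of s t v]
      by (simp flip: Suc.hyps(2))
    finally have "card (bicliques s t V E) \<le> card (bicliques s t (V - {v}) E) +
      ((d choose s) * diff_choose k s (t - 1) + (d choose t) * diff_choose k t (s - 1))"
      by simp
    then show ?thesis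
      using IH lt by (simp flip: Suc.hyps(2))
  qed
qed

section \<open>Path-free graphs\<close>

lemma simple_path_complete:
  assumes "distinct p" "\<And>x y. x \<in> set p \<Longrightarrow> y \<in> set p \<Longrightarrow> x \<noteq> y \<Longrightarrow> (x, y) \<in> E"
  shows "simple_path E p"
  using assms
proof (induction p)
  case (Cons x p)
  then show ?case by (cases p) (auto simp: simple_path_Cons)
qed simp

context edge_maximal_graph
begin

text \<open>\<open>adjacentI\<close> with the core in both roles and \<open>a = b = h + 1\<close>;
  its condition becomes \<open>k \<le> 2 * h + 3\<close>.\<close>

lemma core_complete:
  assumes "k \<le> 2 * h + 3" "x \<in> core h V E" "y \<in> core h V E" "x \<noteq> y"
  shows "(x, y) \<in> E"
  by (rule adjacentI[of "core h V E" "core h V E" "Suc h" "Suc h"])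
    (use assms core_degree[OF finite_V] core_subset[of h V E] in \<open>auto simp: Suc_le_eq\<close>)

text \<open>The clause \<open>r \<le> h\<close> is kept because the value of \<open>g\<close> at
  \<open>r\<close> is later identified under this condition.\<close>

lemma card_bicliques_le_labelled_count:
  assumes st: "s \<ge> 1" "t \<ge> 1" and k: "k \<le> card V" "2 * h + 2 \<le> k" "k \<le> 2 * h + 3"
    and deg: "\<And>v. v \<in> V \<Longrightarrow> r \<le> card {u \<in> V. (v, u) \<in> E}"
  shows "card (bicliques s t V E) \<le> labelled_count s t (card V) (k - 1) h \<or>
    r \<le> h \<and> card (bicliques s t V E) \<le> labelled_count s t (card V) (k - 1) r"
proof -
  define H where "H = core h V E"
  have HV: "H \<subseteq> V" by (simp add: H_def core_subset)
  have finH: "finite H" using HV finite_V finite_subset by blast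
  show ?thesis
  proof (cases "H = {}")
    case True
    \<comment> \<open>\<open>k - 1 - h\<close> is the clique size in \<open>labelled_count\<close>
      at parameter \<open>h\<close>, so peeling stops there.\<close>
    then have "card (core h V E) \<le> k - 1 - h" by (simp add: H_def)
    then show ?thesis
      using card_bicliques_peel[OF st sym irrefl finite_V, of h "k - 1 - h"] k(1)
      by (simp add: labelled_count_def)
  next
    case False
    have complete: "(x, y) \<in> E" if "x \<in> H" "y \<in> H" "x \<noteq> y" for x y
      using that core_complete[OF k(3)] by (simp add: H_def)
    have degH: "card {u \<in> H. (v, u) \<in> E} = card H - 1" if "v \<in> H" for v
    proof -
      have "{u \<in> H. (v, u) \<in> E} = H - {v}"
        using complete that irrefl by (auto simp: irrefl_def)
      then show ?thesis using that finH by simp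
    qed
    obtain v where v: "v \<in> H" using False by blast
    have hH: "h + 2 \<le> card H"
      using core_degree[OF finite_V, of v h E] v degH[OF v] by (simp add: H_def)
    have Hk: "card H < k"
    proof -
      obtain p where p: "set p = H" "distinct p" using finite_distinct_list[OF finH] by blast
      then have "length p < k"
        using no_path[OF simple_path_complete[OF p(2)]] complete HV by blast
      then show ?thesis using p distinct_card by force
    qed
    \<comment> \<open>A vertex joined to all of \<open>H\<close> could be added to the core, since
      all degrees in the enlarged set exceed \<open>h\<close>.\<close>
    have absorb: "x \<in> H" if x: "x \<in> V" "\<And>y. y \<in> H \<Longrightarrow> x \<noteq> y \<Longrightarrow> (x, y) \<in> E" for x
    proof (rule ccontr)
      assume "x \<notin> H"
      have "h < card {u \<in> insert x H. (v, u) \<in> E}" if "v \<in> insert x H" for v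
      proof (cases "v = x")
        case True
        have "card H \<le> card {u \<in> insert x H. (v, u) \<in> E}"
          using x(2) \<open>x \<notin> H\<close> finH True by (intro card_mono) auto
        then show ?thesis using hH by linarith
      next
        case False
        then have "card H - 1 \<le> card {u \<in> insert x H. (v, u) \<in> E}"
          using that finH by (subst degH[symmetric, of v]) (auto intro!: card_mono)
        then show ?thesis using hH by linarith
      qed
      then have "insert x H \<subseteq> core h V E" using x(1) HV by (intro core_upper) auto
      then show False using \<open>x \<notin> H\<close> by (auto simp: H_def)
    qed
    have "H \<noteq> V" using Hk k(1) by auto
    then obtain x0 where x0: "x0 \<in> V" "x0 \<notin> H" using HV by blast
    \<comment> \<open>Otherwise \<open>adjacentI\<close> for \<open>V\<close> with degree
      \<open>r\<close> and \<open>H\<close> with degree \<open>card H - 1\<close> joins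
      \<open>x0\<close> to all of \<open>H\<close>.\<close>
    have rk: "r + card H < k"
    proof (rule ccontr)
      assume "\<not> r + card H < k"
      then have "(x0, y) \<in> E" if "y \<in> H" "x0 \<noteq> y" for y
        by (intro adjacentI[of V H r "card H - 1" x0 y])
          (use that x0 HV deg degH hH in auto)
      then show False using absorb[OF x0(1)] x0(2) by blast
    qed
    \<comment> \<open>Chosen so that the clique size \<open>k - 1 - a\<close> at parameter
      \<open>a\<close> equals \<open>card H\<close>.\<close>
    define a where "a = k - 1 - card H"
    have a: "r \<le> a" "a \<le> h" "k - 1 - a = card H"
      using rk hH Hk k(3) by (auto simp: a_def)
    \<comment> \<open>\<open>adjacentI\<close> is applied at equality:
      \<open>Suc a + (card H - 1) + 1 = k\<close>.\<close>
    have "core a V E \<subseteq> H"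
    proof
      fix x assume x: "x \<in> core a V E"
      have "x \<in> V" using x core_subset by (rule subsetD[rotated])
      moreover have "(x, y) \<in> E" if "y \<in> H" "x \<noteq> y" for y
      proof (rule adjacentI[of "core a V E" H "Suc a" "card H - 1"])
        show "Suc a \<le> card {u \<in> core a V E. (v, u) \<in> E}" if "v \<in> core a V E" for v
          using core_degree[OF finite_V that] by simp
        show "k \<le> Suc a + (card H - 1) + 1" using a(3) hH by (simp add: a_def)
      qed (use that x HV degH core_subset[of a V E] in auto)
      ultimately show "x \<in> H" by (rule absorb)
    qed
    then have "card (core a V E) \<le> card H" using finH by (rule card_mono[rotated])
    then have "card (bicliques s t V E) \<le> labelled_count s t (card V) (k - 1) a"
      using card_bicliques_peel[OF st sym irrefl finite_V, of a "card H"] a(3)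
        card_mono[OF finite_V HV] by (simp add: labelled_count_def)
    moreover have "real (labelled_count s t (card V) (k - 1) a) \<le>
      max (real (labelled_count s t (card V) (k - 1) r)) (real (labelled_count s t (card V) (k - 1) h))"
      using k a by (intro labelled_count_le_max st) auto
    ultimately show ?thesis using a by linarith
  qed
qed

end

text \<open>Adding edges preserves connectivity and can only raise degrees and the number of
  bicliques, so an edge-maximal supergraph may be bounded instead.\<close>

lemma card_bicliques_path_free:
  assumes st: "s \<ge> 1" "t \<ge> 1" and k: "k \<le> card V" "2 * h + 2 \<le> k" "k \<le> 2 * h + 3"
    and E: "finite V" "E \<subseteq> V \<times> V" "sym E" "irrefl E"
    and conn: "\<And>u v. u \<in> V \<Longrightarrow> v \<in> V \<Longrightarrow> (u, v) \<in> E\<^sup>*"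
    and free: "\<And>p. simple_path E p \<Longrightarrow> set p \<subseteq> V \<Longrightarrow> length p < k"
    and deg: "\<And>v. v \<in> V \<Longrightarrow> r \<le> card {u \<in> V. (v, u) \<in> E}"
  shows "card (bicliques s t V E) \<le> labelled_count s t (card V) (k - 1) h \<or>
    r \<le> h \<and> card (bicliques s t V E) \<le> labelled_count s t (card V) (k - 1) r"
proof -
  obtain F where F: "E \<subseteq> F" "F \<subseteq> V \<times> V" "sym F" "irrefl F"
    "\<And>p. simple_path F p \<Longrightarrow> set p \<subseteq> V \<Longrightarrow> length p < k"
    "\<And>x y. x \<in> V \<Longrightarrow> y \<in> V \<Longrightarrow> x \<noteq> y \<Longrightarrow> (x, y) \<notin> F \<Longrightarrow>
       \<exists>p q. linked F x y p q \<and> k \<le> length (x # p) + length (y # q)"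
    using edge_maximal_extension[OF E free] by metis
  interpret edge_maximal_graph V F k
  proof
    show "(u, v) \<in> F\<^sup>*" if "u \<in> V" "v \<in> V" for u v
      using conn[OF that] rtrancl_mono[OF F(1)] by blast
  qed (use E F in auto)
  have "r \<le> card {u \<in> V. (v, u) \<in> F}" if "v \<in> V" for v
    by (rule order_trans[OF deg[OF that] card_mono]) (use E(1) F(1) in auto)
  moreover have "card (bicliques s t V E) \<le> card (bicliques s t V F)"
    using F(1) by (intro card_mono finite_bicliques E(1)) (auto simp: bicliques_def)
  ultimately show ?thesis
    using card_bicliques_le_labelled_count[OF st k, of r] by fastforce
qed

section \<open>Comparison with the formula for \<open>g\<close>\<close>

lemma ibinom_int [simp]: "ibinom (int m) j = m choose j"
  by (simp add: ibinom_def)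

text \<open>The substitution \<open>j = n - i\<close> turns the number of a deletion into the number
  of vertices left. For \<open>s = t\<close> both summands of \<open>labelled_count\<close>
  coincide, so halving leaves one of them.\<close>

lemma g_eq_labelled_count:
  assumes "a \<le> c" "c \<le> n"
  shows "g s t (int n) (int c) (int a) =
    (if s = t then real (labelled_count s t n c a) / 2 else real (labelled_count s t n c a))"
proof -
  have reindex: "(\<Sum>i = 1..int n - int c + int a. f (int n - i)) = (\<Sum>j = c - a..<n. f (int j))"
    for f :: "int \<Rightarrow> real"
    by (rule sum.reindex_bij_witness[of _ "\<lambda>j. int n - int j" "\<lambda>i. nat (int n - i)"])
      (use assms in auto)
  have diff: "ibinom (int j - int i) u = diff_choose j i u" for i j u
    by (auto simp: ibinom_def diff_choose_def nat_diff_distrib)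
  have ca: "ibinom (int c - int a) u = (c - a) choose u" for u
    using assms(1) by (simp add: ibinom_def nat_diff_distrib)
  have sum: "(\<Sum>i = 1..int n - int c + int a.
      real (ibinom (int a) i1) * real (ibinom (int n - int i1 - i) u)) =
      (\<Sum>j = c - a..<n. real (a choose i1) * real (diff_choose j i1 u))" for i1 u
    using reindex[of "\<lambda>x. real (a choose i1) * real (ibinom (x - int i1) u)"]
    by (simp add: diff algebra_simps)
  show ?thesis
  proof (cases "s = t")
    case True
    then show ?thesis
      unfolding g_def labelled_count_def ca sum
      by (simp add: sum.distrib sum_distrib_left[symmetric] mult_2[symmetric])
  next
    case False
    then show ?thesis
      unfolding g_def labelled_count_def ca sum sum.distrib by simp
  qed
qed

text \<open>Every fibre over the image contains a pair together with its distinct swap.\<close>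

lemma double_card_image_swap_le:
  assumes "finite A" "\<And>x y. (x, y) \<in> A \<Longrightarrow> (y, x) \<in> A \<and> x \<noteq> y \<and> f (x, y) = f (y, x)"
  shows "2 * card (f ` A) \<le> card A"
proof -
  have "2 * card (f ` A) = (\<Sum>z\<in>f ` A. 2)" by simp
  also have "\<dots> \<le> (\<Sum>z\<in>f ` A. card {p \<in> A. f p = z})"
  proof (rule sum_mono)
    fix z assume "z \<in> f ` A"
    then obtain x y where xy: "(x, y) \<in> A" "z = f (x, y)" by auto
    then have "{(x, y), (y, x)} \<subseteq> {p \<in> A. f p = z}" using assms(2) by auto
    then have "card {(x, y), (y, x)} \<le> card {p \<in> A. f p = z}" using assms(1) by (intro card_mono) auto
    then show "2 \<le> card {p \<in> A. f p = z}" using assms(2)[OF xy(1)] by (simp add: card_insert_if)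
  qed
  also have "\<dots> = card A" using sum.image_gen[OF assms(1), of "\<lambda>_. 1 :: nat" f] by simp
  finally show ?thesis .
qed

section \<open>Bicliques and paths in digraphs\<close>

lemma vwalk_arcs_subset:
  "successively (\<lambda>u v. (u, v) \<in> E) p \<Longrightarrow> set (vwalk_arcs p) \<subseteq> E"
  by (induction p rule: vwalk_arcs.induct) auto

context graph
begin

lemma sym_arcs_ends: "sym (arcs_ends G)"
  using sym_arcs by (simp add: symmetric_def)

lemma irrefl_arcs_ends: "irrefl (arcs_ends G)"
  using adj_not_same by (auto simp: irrefl_def)

lemma arcs_ends_subset: "arcs_ends G \<subseteq> verts G \<times> verts G"
  using adj_in_verts by auto

lemma card_neighbours: "card {u \<in> verts G. (v, u) \<in> arcs_ends G} = out_degree G v"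
proof -
  have "{u \<in> verts G. (v, u) \<in> arcs_ends G} = head G ` out_arcs G v"
    by (auto simp: arcs_ends_conv)
  moreover have "inj_on (head G) (out_arcs G v)"
    by (rule inj_onI) (auto intro!: no_multi_arcs simp: arc_to_ends_def)
  ultimately show ?thesis by (simp add: out_degree_def card_image)
qed

text \<open>A copy is determined by its two sides, because parallel arcs are excluded.\<close>

definition copy_on :: "'a set \<times> 'a set \<Rightarrow> ('a, 'b) pre_digraph" where
  "copy_on = (\<lambda>(S, T). \<lparr>verts = S \<union> T,
     arcs = {e \<in> arcs G. arc_to_ends G e \<in> S \<times> T \<union> T \<times> S}, tail = tail G, head = head G\<rparr>)"

lemma complete_bipartite_subgraphs:
  "{H. subgraph H G \<and> complete_bipartite_digraph s t H}
     \<subseteq> copy_on ` bicliques s t (verts G) (arcs_ends G)"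
proof
  fix H assume "H \<in> {H. subgraph H G \<and> complete_bipartite_digraph s t H}"
  then have sub: "subgraph H G" and "complete_bipartite_digraph s t H" by auto
  then obtain S T where ST: "verts H = S \<union> T" "S \<inter> T = {}" "card S = s" "card T = t"
      "arcs_ends H = S \<times> T \<union> T \<times> S"
    by (auto simp: complete_bipartite_digraph_def)
  have eq: "tail H = tail G" "head H = head G" and arcs: "arcs H \<subseteq> arcs G"
    and verts: "verts H \<subseteq> verts G"
    using sub by (auto simp: subgraph_def compatible_def)
  have ends: "arc_to_ends H = arc_to_ends G" by (simp add: fun_eq_iff arc_to_ends_def eq)
  have "arcs H = {e \<in> arcs G. arc_to_ends G e \<in> S \<times> T \<union> T \<times> S}"
  proof (intro equalityI subsetI)
    fix e assume "e \<in> arcs H"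
    then have "arc_to_ends G e \<in> arcs_ends H" by (simp add: arcs_ends_def ends)
    then show "e \<in> {e \<in> arcs G. arc_to_ends G e \<in> S \<times> T \<union> T \<times> S}"
      using \<open>e \<in> arcs H\<close> arcs ST(5) by auto
  next
    fix e assume e: "e \<in> {e \<in> arcs G. arc_to_ends G e \<in> S \<times> T \<union> T \<times> S}"
    then have "arc_to_ends G e \<in> arc_to_ends G ` arcs H"
      using ST(5) by (simp add: arcs_ends_def ends)
    then obtain e' where "e' \<in> arcs H" "arc_to_ends G e = arc_to_ends G e'" by blast
    then show "e \<in> arcs H" using no_multi_arcs[of e e'] e arcs by auto
  qed
  then have "H = copy_on (S, T)" by (simp add: copy_on_def ST(1) eq)
  moreover have "arcs_ends H \<subseteq> arcs_ends G" using arcs by (auto simp: arcs_ends_def ends)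
  then have "(S, T) \<in> bicliques s t (verts G) (arcs_ends G)"
    using ST verts by (auto simp: bicliques_def)
  ultimately show "H \<in> copy_on ` bicliques s t (verts G) (arcs_ends G)" by (rule image_eqI)
qed

text \<open>Every copy comes from an ordered pair of sides. For \<open>s = t\<close> the swapped
  pair gives the same copy, and \<open>s \<ge> 1\<close> makes the two pairs different.\<close>

lemma num_complete_bipartite_le:
  assumes "s \<ge> 1"
  shows "(if s = t then 2 else 1) * num_complete_bipartite s t G
    \<le> card (bicliques s t (verts G) (arcs_ends G))"
proof -
  let ?B = "bicliques s t (verts G) (arcs_ends G)"
  have fin: "finite ?B" by (rule finite_bicliques) simp
  have "num_complete_bipartite s t G \<le> card (copy_on ` ?B)"
    unfolding num_complete_bipartite_def
    using fin by (intro card_mono complete_bipartite_subgraphs) simp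
  moreover have "card (copy_on ` ?B) \<le> card ?B" using fin by (rule card_image_le)
  moreover have "2 * card (copy_on ` ?B) \<le> card ?B" if "s = t"
  proof (rule double_card_image_swap_le[OF fin])
    fix S T assume ST: "(S, T) \<in> ?B"
    then have "(T, S) \<in> ?B" "S \<inter> T = {}" "card S \<ge> 1"
      using that assms sym_arcs_ends by (auto simp: bicliques_def dest: symD)
    moreover have "copy_on (S, T) = copy_on (T, S)" unfolding copy_on_def prod.case
      by (simp only: Un_commute)
    moreover have "S \<noteq> T" using calculation by auto
    ultimately show "(T, S) \<in> ?B \<and> S \<noteq> T \<and> copy_on (S, T) = copy_on (T, S)" by blast
  qed
  ultimately show ?thesis by auto
qed

lemma long_simple_path_imp_vpath:
  assumes "simple_path (arcs_ends G) p" "set p \<subseteq> verts G" "k \<le> length p" "k \<ge> 1"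
  shows "\<exists>q. vpath q G \<and> length q = k"
proof -
  have "simple_path (arcs_ends G) (take k p)"
    using assms(1) simple_path_append[of _ "take k p" "drop k p"] by simp
  then have "vpath (take k p) G"
    using assms set_take_subset[of k p] vwalk_arcs_subset[of "arcs_ends G" "take k p"]
    by (auto simp: vpath_def vwalk_def simple_path_def)
  then show ?thesis using assms(3) by (intro exI[of _ "take k p"]) simp
qed

end

theorem theorem2p5:
  fixes G :: "('a, 'b) pre_digraph"
    and s t :: nat and n k r h :: int
  assumes "s \<ge> 1" and "t \<ge> 1"
    and "n \<ge> k" and "k \<ge> 4" and "r \<ge> 1"
    and "graph G" and "connected G"
    and "int (card (verts G)) = n"
    and "int (min_degree G) \<ge> r"
    and "h = \<lfloor>(real_of_int k - 2) / 2\<rfloor>"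
    and "real (num_complete_bipartite s t G) > max (g s t n (k - 1) r) (g s t n (k - 1) h)"
  shows "\<exists>p. vpath p G \<and> int (length p) = k"
proof (rule ccontr)
  assume nopath: "\<not> ?thesis"
  interpret graph G by fact
  let ?V = "verts G" and ?E = "arcs_ends G"
  define K where "K = nat k"
  define R where "R = nat r"
  define H where "H = (K - 2) div 2"
  have K: "k = int K" "K \<ge> 4" "K \<le> card ?V" using assms by (auto simp: K_def)
  have R: "r = int R" using assms by (simp add: R_def)
  have "(real_of_int k - 2) / 2 = real_of_int (int (K - 2)) / real_of_int 2"
    using K by (simp add: of_nat_diff)
  then have H: "h = int H"
    unfolding assms(10) H_def using floor_divide_of_int_eq[of "int (K - 2)" 2, where 'a = real]
    by (simp only: zdiv_int of_nat_numeral)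
  have free: "length p < K" if "simple_path ?E p" "set p \<subseteq> ?V" for p
    using long_simple_path_imp_vpath[OF that, of K] nopath K by (cases "K \<le> length p") auto
  have conn: "(u, v) \<in> ?E\<^sup>*" if "u \<in> ?V" "v \<in> ?V" for u v
    using symmetric_connected_imp_strongly_connected[OF sym_arcs assms(7)] that
    by (auto simp: strongly_connected_def intro: reachable_rtranclI)
  have deg: "R \<le> card {u \<in> ?V. (v, u) \<in> ?E}" if "v \<in> ?V" for v
  proof -
    have "min_degree G \<le> out_degree G v" using that by (simp add: min_degree_def)
    then show ?thesis using assms(9) R by (simp add: card_neighbours)
  qed
  \<comment> \<open>By parity, \<open>K\<close> is \<open>2 * H + 2\<close> or
    \<open>2 * H + 3\<close>.\<close>
  have "K \<le> 2 * H + 3" "2 * H + 2 \<le> K" using K by (auto simp: H_def)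
  note bound = card_bicliques_path_free[OF assms(1,2) K(3) this(2,1) finite_verts
      arcs_ends_subset sym_arcs_ends irrefl_arcs_ends conn free deg]
  have c: "k - 1 = int (K - 1)" using K by simp
  have n: "n = int (card ?V)" using assms by simp
  have g: "g s t n (k - 1) (int a) =
      (if s = t then real (labelled_count s t (card ?V) (K - 1) a) / 2
       else real (labelled_count s t (card ?V) (K - 1) a))" if "a \<le> H" for a
    unfolding c n by (rule g_eq_labelled_count) (use that K in \<open>auto simp: H_def\<close>)
  \<comment> \<open>Either alternative of \<open>bound\<close> contradicts the assumed lower bound,
    at \<open>H\<close> or at \<open>R\<close>; in the latter case it also provides
    \<open>R \<le> H\<close>, as the formula for \<open>g\<close> requires.\<close>
  show False
    using bound num_complete_bipartite_le[OF assms(1), of t] assms(11) g[of H] g[of R]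
    unfolding H R by (auto split: if_splits)
qed

end
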